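(* (Fermionic state-channel isomorphism.) Let $N\ge1$ and $d=2^N$. The map $$\mathcal E\longmapsto\rho^f_{\mathcal E}=(\mathbb I\wedge\mathcal E)(|\psi^+\rangle\langle\psi^+|_f)$$ is a bijection from the set of fermionic channels $\mathcal E$ on an $N$-mode system onto the set of $N\times N$-mode fermionic states whose reduced state on the first subsystem is $\mathbb I/d$.
   Context: Fermionic setting. An $N$-mode fermionic system has the $d=2^N$ dimensional Fock space with orthonormal occupation-number basis $f_{j_1}^\dagger\cdots f_{j_k}^\dagger|\Omega\rangle$ ($j_1<\dots<j_k$). The basis vectors with $k$ even are denoted $|E_1\rangle,\dots,|E_{d/2}\rangle$ and those with $k$ odd $|O_1\rangle,\dots,|O_{d/2}\rangle$. An operator is block-diagonal (BD) if it lies in the span of the $|E_i\rangle\langle E_j|$, $|O_i\rangle\langle O_j|$, and anti-block-diagonal (ABD) if it lies in the span of the $|E_i\rangle\langle O_j|$, $|O_i\rangle\langle E_j|$. For a bipartite system $AB$ of $N+N$ modes, the vectors $|x\rangle\wedge|y\rangle$ (where $|x\rangle$ ranges over the basis $\{|E_1\rangle,\dots,|E_{d/2}\rangle,|O_1\rangle,\dots,|O_{d/2}\rangle\}$ of $A$ and $|y\rangle$ over the corresponding basis of $B$; creation operators of $A$ to the left of those of $B$, applied to the vacuum) form an orthonormal basis; $\langle x|\wedge\langle y|$ is the bra dual to $|x\rangle\wedge|y\rangle$; and the wedge product of operators is the bilinear extension of $|x\rangle\langle x'|\wedge|y\rangle\langle y'|=(|x\rangle\wedge|y\rangle)(\langle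 x'|\wedge\langle y'|)$. A fermionic state is a density operator commuting with total fermion parity (parity superselection rule). The reduced state $\rho_A$ of a fermionic state $\rho_{AB}$ is determined by $\mathrm{tr}(\mathcal O_A\rho_A)=\mathrm{tr}((\mathcal O_A\wedge\mathbb I_B)\rho_{AB})$. A fermionic channel is a completely positive trace-preserving linear map $\mathcal E(X)=\sum_mK_mXK_m^\dagger$ on operators of the $N$-mode system with every $K_m$ BD or ABD; $(\mathbb I\wedge\mathcal E)(Y)=\sum_m(\mathbb I\wedge K_m)Y(\mathbb I\wedge K_m^\dagger)$, equivalently $|x\rangle\langle x'|\wedge|y\rangle\langle y'|\mapsto|x\rangle\langle x'|\wedge\mathcal E(|y\rangle\langle y'|)$. The state $|\psi^+\rangle_f=\frac1{\sqrt d}\sum_{i=1}^{d/2}(|E_i\rangle\wedge|E_i\rangle+|O_i\rangle\wedge|O_i\rangle)$. *)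

theory Defs
  imports "HOL-Analysis.Analysis"
begin

section \<open>Fock space\<close>

text \<open>The modes are the elements of a finite linearly ordered type \<open>'m\<close>, so that
  \<open>N = CARD('m) \<ge> 1\<close>. The Fock space has one coordinate for each set of occupied modes, and an
  operator is its matrix in these coordinates. The joint system of \<open>'a\<close> and \<open>'b\<close> has the modes
  \<open>'a + 'b\<close>, those of the first subsystem preceding those of the second.\<close>

type_synonym 'm fock = "complex ^ 'm set"
type_synonym 'm oper = "complex ^ 'm set ^ 'm set"

instantiation sum :: (linorder, linorder) linorder
begin

fun less_eq_sum :: "'a + 'b \<Rightarrow> 'a + 'b \<Rightarrow> bool" where
  "less_eq_sum (Inl x) (Inl y) \<longleftrightarrow> x \<le> y"
| "less_eq_sum (Inl x) (Inr y) \<longleftrightarrow> True"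
| "less_eq_sum (Inr x) (Inl y) \<longleftrightarrow> False"
| "less_eq_sum (Inr x) (Inr y) \<longleftrightarrow> x \<le> y"

definition less_sum :: "'a + 'b \<Rightarrow> 'a + 'b \<Rightarrow> bool" where
  "less_sum x y \<longleftrightarrow> x \<le> y \<and> \<not> y \<le> x"

instance
proof
  fix x y z :: "'a + 'b"
  show "x < y \<longleftrightarrow> x \<le> y \<and> \<not> y \<le> x" by (rule less_sum_def)
  show "x \<le> x" by (cases x) auto
  show "x \<le> y \<Longrightarrow> y \<le> z \<Longrightarrow> x \<le> z" by (cases x; cases y; cases z) auto
  show "x \<le> y \<Longrightarrow> y \<le> x \<Longrightarrow> x = y" by (cases x; cases y) auto
  show "x \<le> y \<or> y \<le> x" by (cases x; cases y) auto
qed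

end

lemma less_sum_simps [simp]:
  "(Inl x :: 'a::linorder + 'b::linorder) < Inl x' \<longleftrightarrow> x < x'"
  "(Inr y :: 'a::linorder + 'b::linorder) < Inr y' \<longleftrightarrow> y < y'"
  "(Inl x :: 'a::linorder + 'b::linorder) < Inr y"
  by (auto simp: less_sum_def)

definition cinner :: "complex ^ 'i \<Rightarrow> complex ^ 'i \<Rightarrow> complex" where
  "cinner v w = (\<Sum>i\<in>UNIV. cnj (v $ i) * w $ i)"

definition adj :: "complex ^ 'i ^ 'i \<Rightarrow> complex ^ 'i ^ 'i" where
  "adj X = (\<chi> i j. cnj (X $ j $ i))"

definition ketbra :: "complex ^ 'i \<Rightarrow> complex ^ 'i \<Rightarrow> complex ^ 'i ^ 'i" where
  "ketbra v w = (\<chi> i j. v $ i * cnj (w $ j))"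

definition scale :: "complex \<Rightarrow> complex ^ 'i ^ 'i \<Rightarrow> complex ^ 'i ^ 'i" where
  "scale c X = (\<chi> i j. c * X $ i $ j)"

lemma vector_space_scale: "vector_space scale"
  by unfold_locales (simp_all add: scale_def vec_eq_iff algebra_simps)

text \<open>The sign makes the creation operators of different modes anticommute.\<close>

definition creation :: "'m::{finite,linorder} \<Rightarrow> 'm oper" where
  "creation j = (\<chi> S T. if j \<notin> T \<and> S = insert j T then (-1) ^ card {k\<in>T. k < j} else 0)"

lemma matrix_vector_axis: "X *v axis j 1 = (\<chi> i. X $ i $ j)" for X :: "complex ^ 'i::finite ^ 'i"
  by (simp add: vec_eq_iff matrix_vector_mult_def axis_def if_distrib[of "\<lambda>c. _ * c"] cong: if_cong)

lemma creation_axis: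
  "creation j *v axis S 1 = (if j \<in> S then 0 else (-1) ^ card {k\<in>S. k < j} *s axis (insert j S) 1)"
  unfolding matrix_vector_axis by (auto simp: creation_def vec_eq_iff axis_def)

lemma adj_creation_axis:
  "adj (creation j) *v axis S 1 =
     (if j \<in> S then (-1) ^ card {k\<in>S. k < j} *s axis (S - {j}) 1 else 0)"
proof -
  have *: "{k. (k = j \<or> k \<in> T) \<and> k < j} = {k\<in>T. k < j}" for T by auto
  show ?thesis
    unfolding matrix_vector_axis by (auto simp: creation_def adj_def vec_eq_iff axis_def *)
qed

lemma oper_eqI:
  fixes X Y :: "complex ^ 'i::finite ^ 'i"
  assumes "\<And>i. X *v axis i 1 = Y *v axis i 1"
  shows "X = Y"
  using assms unfolding matrix_vector_axis by (simp add: vec_eq_iff)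

lemma sign_insert:
  fixes S :: "'m::{finite,linorder} set"
  assumes "i \<notin> S"
  shows "(-1 :: complex) ^ card {k. (k = i \<or> k \<in> S) \<and> k < j} =
    (if i < j then - 1 else 1) * (-1) ^ card {k\<in>S. k < j}"
proof -
  have "{k. (k = i \<or> k \<in> S) \<and> k < j} = (if i < j then insert i {k\<in>S. k < j} else {k\<in>S. k < j})"
    by auto
  then show ?thesis using assms by simp
qed

lemma matrix_vector_smult: "X *v (c *s v) = c *s (X *v v)" for X :: "complex ^ 'i::finite ^ 'i"
  by (simp add: vec_eq_iff matrix_vector_mult_def sum_distrib_left mult.left_commute)

lemma creation_anticommute:
  "creation i ** creation j + creation j ** creation i = 0"
proof (rule oper_eqI)
  fix S :: "'a set"
  have "creation i *v (creation j *v axis S 1) + creation j *v (creation i *v axis S 1) = 0"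
  proof (cases "i = j \<or> i \<in> S \<or> j \<in> S")
    case True
    then show ?thesis by (auto simp: creation_axis matrix_vector_smult)
  next
    case False
    then have "i < j \<and> \<not> j < i \<or> j < i \<and> \<not> i < j" by auto
    with False show ?thesis
      by (auto simp: creation_axis matrix_vector_smult sign_insert insert_commute vec_eq_iff)
  qed
  then show "(creation i ** creation j + creation j ** creation i) *v axis S 1 = 0 *v axis S 1"
    by (simp add: matrix_vector_mult_add_rdistrib matrix_vector_mul_assoc)
qed

lemma annihilation_creation_anticommute:
  "adj (creation i) ** creation j + creation j ** adj (creation i) = mat (if i = j then 1 else 0)"
proof (rule oper_eqI)
  fix S :: "'a set"
  have "adj (creation i) *v (creation j *v axis S 1) + creation j *v (adj (creation i) *v axis S 1) =
    (if i = j then axis S 1 else 0)"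
  proof (cases "i = j")
    case True
    have "{k. (k = j \<or> k \<in> S) \<and> k < j} = {k\<in>S. k < j}"
      "{k. k \<in> S \<and> k \<noteq> j \<and> k < j} = {k\<in>S. k < j}" by auto
    with True show ?thesis
      by (auto simp: creation_axis adj_creation_axis matrix_vector_smult insert_absorb vec_eq_iff)
  next
    case False
    show ?thesis
    proof (cases "i \<in> S \<and> j \<notin> S")
      case True
      define T where "T = S - {i}"
      have S: "S = insert i T" "i \<notin> T" "j \<notin> T" using True by (auto simp: T_def)
      have D: "insert j (insert i T) - {i} = insert j T" "insert i T - {i} = T"
        "{k. (k = j \<or> k = i \<or> k \<in> T) \<and> k < i} = {k. (k = j \<or> k \<in> T) \<and> k < i}"
        using S False by auto
      have "adj (creation i) *v (creation j *v axis S 1) =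
          ((if i < j then - 1 else 1) * (-1) ^ card {k\<in>T. k < j} *
           ((if j < i then - 1 else 1) * (-1) ^ card {k\<in>T. k < i})) *s axis (insert j T) 1"
        using S(2,3) False
        by (simp add: S(1) creation_axis adj_creation_axis matrix_vector_smult sign_insert D
            del: insert_Diff_if)
      moreover have "creation j *v (adj (creation i) *v axis S 1) =
          ((-1) ^ card {k\<in>T. k < i} * (-1) ^ card {k\<in>T. k < j}) *s axis (insert j T) 1"
        using S(2,3) False
        by (simp add: S(1) creation_axis adj_creation_axis matrix_vector_smult sign_insert D
            del: insert_Diff_if)
      moreover have "i < j \<and> \<not> j < i \<or> j < i \<and> \<not> i < j" using False by auto
      ultimately show ?thesis using False by (auto simp: vec_eq_iff)
    qed (use False in \<open>auto simp: creation_axis adj_creation_axis matrix_vector_smult\<close>)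
  qed
  then show "(adj (creation i) ** creation j + creation j ** adj (creation i)) *v axis S 1 =
      mat (if i = j then 1 else 0) *v axis S 1"
    by (auto simp: matrix_vector_mult_add_rdistrib matrix_vector_mul_assoc mat_0)
qed

definition vacuum :: "'m::{finite,linorder} fock" where
  "vacuum = axis {} 1"

text \<open>The product of the creation operators of a list of modes, in the order of the list,
  applied to the vacuum.\<close>

definition create :: "'m::{finite,linorder} list \<Rightarrow> 'm fock" where
  "create js = foldr (\<lambda>j v. creation j *v v) js vacuum"

definition occ :: "'m::{finite,linorder} set \<Rightarrow> 'm fock" where
  "occ S = create (sorted_list_of_set S)"

text \<open>\<open>wedge_ket S T\<close> is the wedge product of \<open>occ S\<close> and \<open>occ T\<close>.\<close>

definition wedge_ket ::
    "'a::{finite,linorder} set \<Rightarrow> 'b::{finite,linorder} set \<Rightarrow> ('a + 'b) fock" where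
  "wedge_ket S T = create (map Inl (sorted_list_of_set S) @ map Inr (sorted_list_of_set T))"

lemma create_axis: "sorted_wrt (<) js \<Longrightarrow> create js = axis (set js) 1"
proof (induction js)
  case (Cons j js)
  then have "j \<notin> set js" "{k\<in>set js. k < j} = {}" by auto
  with Cons show ?case by (simp add: create_def creation_axis del: Collect_empty_eq)
qed (simp add: create_def vacuum_def)

lemma occ_axis: "occ S = axis S 1"
  unfolding occ_def by (subst create_axis) auto

lemma wedge_ket_axis: "wedge_ket S T = axis (S <+> T) 1"
proof -
  have "sorted_wrt (<) (map Inl (sorted_list_of_set S) @ map Inr (sorted_list_of_set T))"
    by (auto simp: sorted_wrt_append sorted_wrt_map)
  then show ?thesis
    unfolding wedge_ket_def by (subst create_axis) (auto simp: Plus_def)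
qed


section \<open>Parity\<close>

definition block_diagonal :: "'m::{finite,linorder} oper \<Rightarrow> bool" where
  "block_diagonal X \<longleftrightarrow> X \<in> module.span scale
     ({ketbra (occ S) (occ T) | S T. even (card S) \<and> even (card T)} \<union>
      {ketbra (occ S) (occ T) | S T. odd (card S) \<and> odd (card T)})"

definition anti_block_diagonal :: "'m::{finite,linorder} oper \<Rightarrow> bool" where
  "anti_block_diagonal X \<longleftrightarrow> X \<in> module.span scale
     ({ketbra (occ S) (occ T) | S T. even (card S) \<and> odd (card T)} \<union>
      {ketbra (occ S) (occ T) | S T. odd (card S) \<and> even (card T)})"

definition parity :: "'m::{finite,linorder} oper" where
  "parity = (\<Sum>S\<in>UNIV. scale ((-1) ^ card S) (ketbra (occ S) (occ S)))"


section \<open>Wedge product of operators\<close>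

definition wedge ::
    "'a::{finite,linorder} oper \<Rightarrow> 'b::{finite,linorder} oper \<Rightarrow> ('a + 'b) oper" where
  "wedge X Y = (\<Sum>x\<in>UNIV. \<Sum>x'\<in>UNIV. \<Sum>y\<in>UNIV. \<Sum>y'\<in>UNIV.
     scale (cinner (occ x) (X *v occ x') * cinner (occ y) (Y *v occ y'))
       (ketbra (wedge_ket x y) (wedge_ket x' y')))"

text \<open>\<open>id_wedge E\<close> is the linear extension of
  \<open>|x><x'| \<and> |y><y'| \<mapsto> |x><x'| \<and> E(|y><y'|)\<close>.\<close>

definition id_wedge ::
    "('b::{finite,linorder} oper \<Rightarrow> 'b oper) \<Rightarrow> ('a::{finite,linorder} + 'b) oper \<Rightarrow> ('a + 'b) oper"
  where
  "id_wedge E Z = (\<Sum>x\<in>UNIV. \<Sum>x'\<in>UNIV. \<Sum>y\<in>UNIV. \<Sum>y'\<in>UNIV.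
     scale (cinner (wedge_ket x y) (Z *v wedge_ket x' y'))
       (wedge (ketbra (occ x) (occ x')) (E (ketbra (occ y) (occ y')))))"


section \<open>States and channels\<close>

text \<open>Over the complex numbers this condition implies that \<open>X\<close> is Hermitian.\<close>

definition positive :: "complex ^ 'i ^ 'i \<Rightarrow> bool" where
  "positive X \<longleftrightarrow> (\<forall>v. cinner v (X *v v) \<in> \<real>\<^sub>\<ge>\<^sub>0)"

definition density_operator :: "complex ^ 'i ^ 'i \<Rightarrow> bool" where
  "density_operator \<rho> \<longleftrightarrow> positive \<rho> \<and> trace \<rho> = 1"

definition fermionic_state :: "'m::{finite,linorder} oper \<Rightarrow> bool" where
  "fermionic_state \<rho> \<longleftrightarrow> density_operator \<rho> \<and> \<rho> ** parity = parity ** \<rho>"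

definition reduced_state ::
    "('a::{finite,linorder} + 'b::{finite,linorder}) oper \<Rightarrow> 'a oper" where
  "reduced_state \<rho> =
     (THE \<sigma>. \<forall>X. trace (X ** \<sigma>) = trace (wedge X (mat 1 :: 'b oper) ** \<rho>))"

text \<open>\<open>completely_positive E\<close>: for every \<open>n\<close>, applying \<open>E\<close> to every entry of a positive
  \<open>n \<times> n\<close> block matrix of operators gives a positive block matrix.\<close>

definition block_positive :: "nat \<Rightarrow> (nat \<Rightarrow> nat \<Rightarrow> complex ^ 'i ^ 'i) \<Rightarrow> bool" where
  "block_positive n X \<longleftrightarrow>
     (\<forall>v. (\<Sum>i<n. \<Sum>j<n. cinner (v i) (X i j *v v j)) \<in> \<real>\<^sub>\<ge>\<^sub>0)"

definition completely_positive :: "(complex ^ 'i ^ 'i \<Rightarrow> complex ^ 'i ^ 'i) \<Rightarrow> bool" where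
  "completely_positive E \<longleftrightarrow>
     (\<forall>n X. block_positive n X \<longrightarrow> block_positive n (\<lambda>i j. E (X i j)))"

definition fermionic_channel ::
    "('m::{finite,linorder} oper \<Rightarrow> 'm oper) \<Rightarrow> bool" where
  "fermionic_channel E \<longleftrightarrow>
     Vector_Spaces.linear scale scale E \<and> completely_positive E \<and> (\<forall>X. trace (E X) = trace X) \<and>
     (\<exists>Ks. (\<forall>K\<in>set Ks. block_diagonal K \<or> anti_block_diagonal K) \<and>
           (\<forall>X. E X = (\<Sum>K\<leftarrow>Ks. K ** X ** adj K)))"

definition psi_plus :: "('m::{finite,linorder} + 'm) fock" where
  "psi_plus = (1 / complex_of_real (sqrt (2 ^ CARD('m)))) *s
     ((\<Sum>S | even (card S). wedge_ket S S) + (\<Sum>S | odd (card S). wedge_ket S S))"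


section \<open>Basic properties\<close>

lemma bij_Plus: "bij (\<lambda>(x :: 'a set, y :: 'b set). x <+> y)"
proof (rule bijI')
  fix p q :: "'a set \<times> 'b set"
  show "(case p of (x, y) \<Rightarrow> x <+> y) = (case q of (x, y) \<Rightarrow> x <+> y) \<longleftrightarrow> p = q"
    by (cases p; cases q) (auto simp: Plus_def)
next
  fix U :: "('a + 'b) set"
  have "U = Inl -` U <+> Inr -` U" by (auto simp: Plus_def image_iff; metis sumE)
  then show "\<exists>p. U = (case p of (x, y) \<Rightarrow> x <+> y)" by auto
qed

lemma sum_Plus:
  "(\<Sum>U\<in>UNIV. f U) = (\<Sum>x\<in>UNIV. \<Sum>y\<in>UNIV. f (x <+> y :: ('a::finite + 'b::finite) set))"
proof -
  have "(\<Sum>U\<in>UNIV. f U) = (\<Sum>p\<in>UNIV. f (case p of (x, y) \<Rightarrow> x <+> y))"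
    using sum.reindex_bij_betw[OF bij_Plus, of f] by simp
  then show ?thesis
    unfolding sum.cartesian_product UNIV_Times_UNIV by (simp add: case_prod_beta)
qed

lemma Plus_inject [simp]: "x <+> y = x' <+> y' \<longleftrightarrow> x = x' \<and> y = y'"
  by (auto simp: Plus_def)

lemma oper_Plus_eqI:
  fixes X Y :: "('a::finite + 'b::finite) oper"
  assumes "\<And>x y x' y'. X $ (x <+> y) $ (x' <+> y') = Y $ (x <+> y) $ (x' <+> y')"
  shows "X = Y"
proof -
  have "X $ U $ V = Y $ U $ V" for U V
  proof -
    obtain p q where "U = (case p of (x, y) \<Rightarrow> x <+> y)" "V = (case q of (x, y) \<Rightarrow> x <+> y)"
      using surjD[OF bij_is_surj[OF bij_Plus]] by metis
    then show ?thesis using assms by (simp add: case_prod_beta)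
  qed
  then show ?thesis by (simp add: vec_eq_iff)
qed

lemma cinner_axis: "cinner (axis i 1) (X *v axis j 1) = X $ i $ j" for X :: "complex ^ 'i::finite ^ 'i"
  unfolding matrix_vector_axis
  by (simp add: cinner_def axis_def if_distrib[of cnj] if_distrib[of "\<lambda>c. c * _"] cong: if_cong)

lemma ketbra_axis: "ketbra (axis i 1) (axis j 1) $ k $ l = (if k = i \<and> l = j then 1 else 0)"
  by (auto simp: ketbra_def axis_def)

lemma wedge_Plus: "wedge X Y $ (x <+> y) $ (x' <+> y') = X $ x $ x' * Y $ y $ y'"
proof -
  have "wedge X Y $ (x <+> y) $ (x' <+> y') =
    (\<Sum>u\<in>UNIV. \<Sum>u'\<in>UNIV. \<Sum>v\<in>UNIV. \<Sum>v'\<in>UNIV.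
      if v' = y' then if v = y then if u' = x' then if u = x then X $ u $ u' * Y $ v $ v' else 0 else 0 else 0 else 0)"
    unfolding wedge_def occ_axis wedge_ket_axis cinner_axis sum_component
    by (intro sum.cong refl) (auto simp: scale_def ketbra_axis)
  also have "\<dots> = X $ x $ x' * Y $ y $ y'" by simp
  finally show ?thesis .
qed

lemma wedge_ketbra:
  "wedge (ketbra (occ x) (occ x')) (ketbra (occ y) (occ y')) = ketbra (wedge_ket x y) (wedge_ket x' y')"
  by (rule oper_Plus_eqI) (simp add: wedge_Plus occ_axis wedge_ket_axis ketbra_axis)

lemma id_wedge_Plus:
  "id_wedge E Z $ (x <+> y) $ (x' <+> y') =
    (\<Sum>v\<in>UNIV. \<Sum>v'\<in>UNIV. Z $ (x <+> v) $ (x' <+> v') * E (ketbra (occ v) (occ v')) $ y $ y')"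
proof -
  have "id_wedge E Z $ (x <+> y) $ (x' <+> y') =
    (\<Sum>u\<in>UNIV. \<Sum>u'\<in>UNIV. if u' = x' then if u = x then
       \<Sum>v\<in>UNIV. \<Sum>v'\<in>UNIV. Z $ (u <+> v) $ (u' <+> v') * E (ketbra (occ v) (occ v')) $ y $ y' else 0 else 0)"
    unfolding id_wedge_def wedge_ket_axis cinner_axis sum_component
    by (intro sum.cong refl) (auto simp: scale_def wedge_Plus ketbra_axis occ_axis)
  then show ?thesis by simp
qed

lemma id_wedge_ketbra:
  "id_wedge E (wedge (ketbra (occ x) (occ x')) (ketbra (occ y) (occ y'))) =
     wedge (ketbra (occ x) (occ x')) (E (ketbra (occ y) (occ y')))"
proof (rule oper_Plus_eqI)
  fix a b a' b'
  have "id_wedge E (wedge (ketbra (occ x) (occ x')) (ketbra (occ y) (occ y'))) $ (a <+> b) $ (a' <+> b') =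
    (\<Sum>v\<in>UNIV. \<Sum>v'\<in>UNIV. if v' = y' then if v = y then if a = x \<and> a' = x' then
       E (ketbra (occ v) (occ v')) $ b $ b' else 0 else 0 else 0)"
    unfolding id_wedge_Plus wedge_Plus occ_axis ketbra_axis
    by (intro sum.cong refl) auto
  also have "\<dots> = wedge (ketbra (occ x) (occ x')) (E (ketbra (occ y) (occ y'))) $ (a <+> b) $ (a' <+> b')"
    by (simp add: wedge_Plus occ_axis ketbra_axis)
  finally show "id_wedge E (wedge (ketbra (occ x) (occ x')) (ketbra (occ y) (occ y'))) $ (a <+> b) $ (a' <+> b') =
    wedge (ketbra (occ x) (occ x')) (E (ketbra (occ y) (occ y'))) $ (a <+> b) $ (a' <+> b')" .
qed

lemma sandwich_ketbra: "(K ** ketbra (axis v 1) (axis v' 1) ** L) $ y $ y' = K $ y $ v * L $ v' $ y'"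
proof -
  have "(K ** ketbra (axis v 1) (axis v' 1) ** L) $ y $ y' =
    (\<Sum>k\<in>UNIV. \<Sum>l\<in>UNIV. if l = v then if k = v' then K $ y $ l * L $ k $ y' else 0 else 0)"
    unfolding matrix_matrix_mult_def vec_lambda_beta ketbra_axis sum_distrib_right
    by (intro sum.cong refl) auto
  then show ?thesis by simp
qed

lemma sum_if_const: "(\<Sum>v\<in>A. if c then f v else 0) = (if c then sum f A else 0)"
  by simp

lemma sandwich_wedge:
  "(wedge (mat 1) K ** Z ** wedge (mat 1) L) $ (x <+> y) $ (x' <+> y') =
    (\<Sum>v\<in>UNIV. \<Sum>v'\<in>UNIV. Z $ (x <+> v) $ (x' <+> v') * (K $ y $ v * L $ v' $ y'))"
proof -
  have "(wedge (mat 1) K ** Z ** wedge (mat 1) L) $ (x <+> y) $ (x' <+> y') =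
    (\<Sum>u'\<in>UNIV. \<Sum>v'\<in>UNIV. \<Sum>u\<in>UNIV. \<Sum>v\<in>UNIV.
      if u' = x' then if u = x then Z $ (u <+> v) $ (u' <+> v') * (K $ y $ v * L $ v' $ y') else 0 else 0)"
    unfolding matrix_matrix_mult_def vec_lambda_beta sum_Plus wedge_Plus sum_distrib_right mat_def
    by (intro sum.cong refl) auto
  also have "\<dots> = (\<Sum>v'\<in>UNIV. \<Sum>v\<in>UNIV. Z $ (x <+> v) $ (x' <+> v') * (K $ y $ v * L $ v' $ y'))"
    by (simp add: sum_if_const)
  finally show ?thesis by (subst sum.swap)
qed

lemma sum_list_nth2: "(\<Sum>K\<leftarrow>Ks. f K) $ i $ j = (\<Sum>K\<leftarrow>Ks. f K $ i $ j)"
  for f :: "'k \<Rightarrow> complex ^ 'i ^ 'i"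
  by (induction Ks) auto

lemma id_wedge_Kraus:
  assumes "\<And>X. E X = (\<Sum>K\<leftarrow>Ks. K ** X ** adj K)"
  shows "id_wedge E Z = (\<Sum>K\<leftarrow>Ks. wedge (mat 1) K ** Z ** wedge (mat 1) (adj K))"
proof (rule oper_Plus_eqI)
  fix x y x' y'
  have "id_wedge E Z $ (x <+> y) $ (x' <+> y') = (\<Sum>v\<in>UNIV. \<Sum>v'\<in>UNIV. \<Sum>K\<leftarrow>Ks.
      Z $ (x <+> v) $ (x' <+> v') * (K $ y $ v * adj K $ v' $ y'))"
    unfolding id_wedge_Plus assms sum_list_nth2 occ_axis sandwich_ketbra
    by (simp add: sum_list_const_mult)
  also have "\<dots> = (\<Sum>K\<leftarrow>Ks. \<Sum>v\<in>UNIV. \<Sum>v'\<in>UNIV.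
      Z $ (x <+> v) $ (x' <+> v') * (K $ y $ v * adj K $ v' $ y'))"
    by (induction Ks) (simp_all add: sum.distrib)
  finally show "id_wedge E Z $ (x <+> y) $ (x' <+> y') =
      (\<Sum>K\<leftarrow>Ks. wedge (mat 1) K ** Z ** wedge (mat 1) (adj K)) $ (x <+> y) $ (x' <+> y')"
    unfolding sum_list_nth2 sandwich_wedge .
qed

lemma reduced_state_unique:
  fixes \<rho> :: "('a::{finite,linorder} + 'b::{finite,linorder}) oper"
  shows "\<exists>!\<sigma>. \<forall>X. trace (X ** \<sigma>) = trace (wedge X (mat 1 :: 'b oper) ** \<rho>)"
proof (rule ex1I)
  let ?\<sigma> = "\<chi> x x'. \<Sum>y\<in>UNIV. \<rho> $ (x <+> y) $ (x' <+> y)"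
  show *: "\<forall>X. trace (X ** ?\<sigma>) = trace (wedge X (mat 1 :: 'b oper) ** \<rho>)"
  proof
    fix X
    have "trace (wedge X (mat 1 :: 'b oper) ** \<rho>) =
      (\<Sum>x\<in>UNIV. \<Sum>y\<in>UNIV. \<Sum>x'\<in>UNIV. \<Sum>y'\<in>UNIV.
        if y' = y then X $ x $ x' * \<rho> $ (x' <+> y') $ (x <+> y) else 0)"
      unfolding trace_def matrix_matrix_mult_def vec_lambda_beta sum_Plus wedge_Plus mat_def
      by (intro sum.cong refl) auto
    also have "\<dots> = (\<Sum>x\<in>UNIV. \<Sum>y\<in>UNIV. \<Sum>x'\<in>UNIV. X $ x $ x' * \<rho> $ (x' <+> y) $ (x <+> y))"
      by simp
    also have "\<dots> = (\<Sum>x\<in>UNIV. \<Sum>x'\<in>UNIV. \<Sum>y\<in>UNIV. X $ x $ x' * \<rho> $ (x' <+> y) $ (x <+> y))"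
      by (intro sum.cong refl sum.swap)
    finally show "trace (X ** ?\<sigma>) = trace (wedge X (mat 1 :: 'b oper) ** \<rho>)"
      by (simp add: trace_def matrix_matrix_mult_def sum_distrib_left)
  qed
  fix \<sigma>
  assume "\<forall>X. trace (X ** \<sigma>) = trace (wedge X (mat 1 :: 'b oper) ** \<rho>)"
  with * have eq: "trace (X ** \<sigma>) = trace (X ** ?\<sigma>)" for X by metis
  have tr: "trace (ketbra (axis j 1) (axis i 1) ** \<tau>) = \<tau> $ i $ j" for i j and \<tau> :: "'a oper"
  proof -
    have "trace (ketbra (axis j 1) (axis i 1) ** \<tau>) =
      (\<Sum>k\<in>UNIV. \<Sum>l\<in>UNIV. if l = i then if k = j then \<tau> $ l $ k else 0 else 0)"
      unfolding trace_def matrix_matrix_mult_def vec_lambda_beta ketbra_axis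
      by (intro sum.cong refl) auto
    then show ?thesis by simp
  qed
  have "\<sigma> $ i $ j = ?\<sigma> $ i $ j" for i j
    using eq[of "ketbra (axis j 1) (axis i 1)"] unfolding tr .
  then show "\<sigma> = ?\<sigma>" by (simp add: vec_eq_iff)
qed

end

theory Submission
  imports Defs
begin

text \<open>In coordinates, \<open>\<rho>\<close> has the entries of the Choi matrix of \<open>E\<close>, divided by \<open>d\<close>, so \<open>E\<close> can be
  read off from \<open>\<rho>\<close>. A Kraus operator \<open>K\<close> of \<open>E\<close> contributes the rank-one term \<open>|k><k|/d\<close>, where \<open>k\<close>
  is the vector of entries of \<open>K\<close>, and \<open>K\<close> is block-diagonal or anti-block-diagonal exactly when \<open>k\<close>
  has even or odd parity. Conversely, the Cholesky algorithm writes a positive matrix as a sum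
  of rank-one terms built from its successive columns; if the matrix commutes with parity, each column
  has a definite parity, and so the resulting Kraus operators are block-diagonal or
  anti-block-diagonal.\<close>

section \<open>Positive matrices\<close>

lemma cinner_add_left: "cinner (u + v) w = cinner u w + cinner v w"
  by (simp add: cinner_def algebra_simps sum.distrib)

lemma cinner_add_right: "cinner u (v + w) = cinner u v + cinner u w"
  by (simp add: cinner_def algebra_simps sum.distrib)

lemma cinner_diff_right: "cinner u (v - w) = cinner u v - cinner u w"
  by (simp add: cinner_def algebra_simps sum_subtractf)

lemma cinner_smult_left: "cinner (c *s u) v = cnj c * cinner u v"
  by (simp add: cinner_def algebra_simps sum_distrib_left)

lemma cinner_smult_right: "cinner u (c *s v) = c * cinner u v"
  by (simp add: cinner_def algebra_simps sum_distrib_left)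

lemma cnj_cinner: "cnj (cinner u v) = cinner v u"
  by (simp add: cinner_def algebra_simps)

lemma cinner_adj: "cinner u (X *v v) = cinner (adj X *v u) v"
proof -
  have "cinner u (X *v v) = (\<Sum>i\<in>UNIV. \<Sum>j\<in>UNIV. cnj (u $ i) * (X $ i $ j * v $ j))"
    by (simp add: cinner_def matrix_vector_mult_def sum_distrib_left)
  also have "\<dots> = (\<Sum>j\<in>UNIV. \<Sum>i\<in>UNIV. cnj (u $ i) * (X $ i $ j * v $ j))"
    by (rule sum.swap)
  also have "\<dots> = cinner (adj X *v u) v"
    by (simp add: cinner_def matrix_vector_mult_def adj_def sum_distrib_left mult_ac)
  finally show ?thesis .
qed

lemma ketbra_mult_vector: "ketbra u v *v w = cinner v w *s u"
  by (simp add: vec_eq_iff ketbra_def matrix_vector_mult_def cinner_def sum_distrib_left mult_ac)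

text \<open>This is the quadratic form of \<open>M\<close> at
  \<open>axis i 1 + c *s axis j 1\<close>. Suitable choices of \<open>c\<close> yield the facts
  about single entries below.\<close>

lemma positive_two_entries:
  assumes "positive M"
  shows "M $ i $ i + c * M $ i $ j + cnj c * M $ j $ i + cnj c * c * M $ j $ j \<in> \<real>\<^sub>\<ge>\<^sub>0"
proof -
  have "cinner (axis i 1 + c *s axis j 1) (M *v (axis i 1 + c *s axis j 1)) \<in> \<real>\<^sub>\<ge>\<^sub>0"
    using assms by (simp add: positive_def)
  then show ?thesis
    by (simp add: matrix_vector_right_distrib matrix_vector_smult cinner_add_left cinner_add_right
        cinner_smult_left cinner_smult_right cinner_axis algebra_simps)
qed

lemma positive_diagonal:
  assumes "positive M"
  shows "M $ i $ i \<in> \<real>\<^sub>\<ge>\<^sub>0"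
  using positive_two_entries[OF assms, of i 0 i] by simp

text \<open>Polarisation: the form is real, so \<open>c = 1\<close> makes the imaginary parts of the
  two off-diagonal entries cancel, and \<open>c = \<i>\<close> makes their real parts agree.\<close>

lemma positive_hermitian:
  assumes "positive M"
  shows "cnj (M $ i $ j) = M $ j $ i"
proof -
  have "Im (M $ i $ i) = 0" "Im (M $ j $ j) = 0"
    using positive_diagonal[OF assms] by (auto simp: complex_nonneg_Reals_iff)
  with positive_two_entries[OF assms, of i 1 j] positive_two_entries[OF assms, of i \<i> j]
  show ?thesis
    by (auto simp: complex_nonneg_Reals_iff complex_eq_iff)
qed

lemma positive_adj: "positive M \<Longrightarrow> adj M = M"
  by (simp add: adj_def vec_eq_iff positive_hermitian)

text \<open>Without its quadratic term, the form at \<open>axis i 1 + c *s axis j 1\<close> is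
  real-affine in \<open>c\<close>, so a nonzero off-diagonal entry would let it become
  negative.\<close>

lemma positive_zero_diagonal:
  assumes "positive M" "M $ j $ j = 0"
  shows "M $ i $ j = 0"
proof (rule ccontr)
  assume nz: "M $ i $ j \<noteq> 0"
  define a where "a = M $ i $ j"
  define n where "n = (cmod a)\<^sup>2"
  have n: "n > 0" using nz by (simp add: n_def a_def)
  \<comment> \<open>Chosen to give the form the value -1: \<open>c * a = - t * n\<close>, and
    \<open>2 * t * n\<close> exceeds the diagonal entry \<open>M $ i $ i\<close> by one.\<close>
  define t where "t = (Re (M $ i $ i) + 1) / (2 * n)"
  define c where "c = - complex_of_real t * cnj a"
  have ji: "M $ j $ i = cnj a" using positive_hermitian[OF assms(1)] by (simp add: a_def)
  have "Re (M $ i $ i) + Re (c * a) + Re (cnj c * cnj a) \<ge> 0"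
    using positive_two_entries[OF assms(1), of i c j] assms(2) ji
    by (auto simp: complex_nonneg_Reals_iff a_def)
  moreover have "Re (c * a) = - t * n" "Re (cnj c * cnj a) = - t * n"
    unfolding n_def cmod_power2 by (simp_all add: c_def power2_eq_square algebra_simps)
  moreover have "t * n = (Re (M $ i $ i) + 1) / 2" using n by (simp add: t_def)
  ultimately show False by argo
qed

text \<open>One elimination step of the Cholesky algorithm, with \<open>v\<close> the column
  \<open>i\<close> divided by the square root of the pivot. Completing the square shows that the
  form of \<open>M - ketbra v v\<close> at \<open>w\<close> equals the form of \<open>M\<close> at a
  shifted vector \<open>w + t *s axis i 1\<close>.\<close>

lemma positive_schur_complement:
  assumes "positive M" "M $ i $ i \<noteq> 0"
    and v: "v = (1 / complex_of_real (sqrt (Re (M $ i $ i)))) *s (M *v axis i 1)"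
  shows "positive (M - ketbra v v)"
  unfolding positive_def
proof
  fix w
  define r where "r = Re (M $ i $ i)"
  have Mii: "M $ i $ i = complex_of_real r" and r: "r > 0"
    using positive_diagonal[OF assms(1), of i] assms(2)
    by (auto simp: r_def complex_nonneg_Reals_iff complex_eq_iff)
  define s where "s = cinner (axis i 1) (M *v w)"
  have s': "cinner w (M *v axis i 1) = cnj s"
    unfolding s_def cnj_cinner by (subst cinner_adj) (simp add: positive_adj assms(1))
  have vw: "cinner v w = (1 / complex_of_real (sqrt r)) * s"
    unfolding v s_def cinner_smult_left r_def[symmetric]
    by (simp add: cinner_adj[of _ M w] positive_adj assms(1))
  have "cinner w v = (1 / complex_of_real (sqrt r)) * cnj s"
    using arg_cong[OF vw, of cnj] by (simp add: cnj_cinner)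
  with vw have vv: "cinner w (ketbra v v *v w) = s * cnj s / complex_of_real r"
    using r by (simp add: ketbra_mult_vector cinner_smult_right flip: of_real_mult)
  \<comment> \<open>The minimiser over complex \<open>t\<close> of the form of \<open>M\<close> at
    \<open>w + t *s axis i 1\<close>; the minimum lies \<open>s * cnj s / r\<close> below the value
    at \<open>w\<close>.\<close>
  define t where "t = - s / complex_of_real r"
  have "cinner (w + t *s axis i 1) (M *v (w + t *s axis i 1)) =
      cinner w (M *v w) + t * cnj s + cnj t * s + cnj t * t * complex_of_real r"
    by (simp add: matrix_vector_right_distrib matrix_vector_smult cinner_add_left cinner_add_right
        cinner_smult_left cinner_smult_right cinner_axis s' Mii algebra_simps flip: s_def)
  also have "\<dots> = cinner w (M *v w) - s * cnj s / complex_of_real r"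
    using r by (simp add: t_def field_simps)
  also have "\<dots> = cinner w ((M - ketbra v v) *v w)"
    by (simp add: matrix_vector_mult_diff_rdistrib cinner_diff_right vv)
  finally show "cinner w ((M - ketbra v v) *v w) \<in> \<real>\<^sub>\<ge>\<^sub>0"
    using assms(1) by (metis positive_def)
qed

text \<open>Induction on the number of nonzero diagonal entries, using any of them as the pivot.
  \<open>p\<close> labels the coordinates; it will be the parity of the occupation number. As
  \<open>M\<close> connects only equal labels, each of its columns carries a single label, and
  subtracting the rank-one term of a column preserves this.\<close>

lemma positive_decomposition:
  assumes "positive M" "\<And>i j. M $ i $ j \<noteq> 0 \<Longrightarrow> p i = p j"
  shows "\<exists>vs. (\<forall>v\<in>set vs. \<exists>a. \<forall>i. v $ i \<noteq> 0 \<longrightarrow> p i = a) \<and> M = (\<Sum>v\<leftarrow>vs. ketbra v v)"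
  using assms
proof (induction "card {i. M $ i $ i \<noteq> 0}" arbitrary: M rule: less_induct)
  case less
  show ?case
  proof (cases "\<exists>i. M $ i $ i \<noteq> 0")
    case False
    then have "M = 0" using positive_zero_diagonal[OF less.prems(1)] by (simp add: vec_eq_iff)
    then show ?thesis by (intro exI[of _ "[]"]) simp
  next
    case True
    then obtain i where i: "M $ i $ i \<noteq> 0" by blast
    define r where "r = Re (M $ i $ i)"
    have Mii: "M $ i $ i = complex_of_real r" and r: "r > 0"
      using positive_diagonal[OF less.prems(1), of i] i
      by (auto simp: r_def complex_nonneg_Reals_iff complex_eq_iff)
    define v where "v = (1 / complex_of_real (sqrt r)) *s (M *v axis i 1)"
    have vk: "v $ k = M $ k $ i / complex_of_real (sqrt r)" for k
      by (simp add: v_def matrix_vector_axis)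
    have p: "p k = p i" if "v $ k \<noteq> 0" for k
      using that less.prems(2) by (simp add: vk)
    let ?M = "M - ketbra v v"
    have pos: "positive ?M"
      using positive_schur_complement[OF less.prems(1) i] by (simp add: v_def r_def)
    \<comment> \<open>A zero diagonal entry of \<open>M\<close> forces a zero entry of
      \<open>v\<close>, so it stays zero. The pivot disappears because \<open>v $ i\<close> has
      square \<open>r\<close>.\<close>
    have "{k. ?M $ k $ k \<noteq> 0} \<subseteq> {k. M $ k $ k \<noteq> 0} - {i}"
    proof -
      have "?M $ k $ k = 0" if "M $ k $ k = 0" for k
      proof -
        have "M $ k $ i = 0"
          using positive_zero_diagonal[OF less.prems(1) that, of i]
            positive_hermitian[OF less.prems(1), of i k] by simp
        then show ?thesis using that by (simp add: ketbra_def vk)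
      qed
      moreover have "?M $ i $ i = 0"
        using r by (simp add: ketbra_def vk Mii flip: of_real_mult of_real_divide of_real_diff)
      ultimately show ?thesis by auto
    qed
    then have "{k. ?M $ k $ k \<noteq> 0} \<subset> {k. M $ k $ k \<noteq> 0}" using i by blast
    then have card: "card {k. ?M $ k $ k \<noteq> 0} < card {k. M $ k $ k \<noteq> 0}"
      by (simp add: psubset_card_mono)
    \<comment> \<open>A nonzero entry of the difference comes either from \<open>ketbra v v\<close>,
      whose support has the label \<open>p i\<close>, or from \<open>M\<close> itself.\<close>
    have "p k = p l" if "?M $ k $ l \<noteq> 0" for k l
    proof (cases "v $ k \<noteq> 0 \<and> v $ l \<noteq> 0")
      case True
      then show ?thesis using p by metis
    next
      case False
      then have "M $ k $ l \<noteq> 0" using that by (auto simp: ketbra_def)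
      then show ?thesis by (rule less.prems(2))
    qed
    from less.hyps[OF card pos this] obtain vs where
      vs: "\<forall>v\<in>set vs. \<exists>a. \<forall>i. v $ i \<noteq> 0 \<longrightarrow> p i = a" "?M = (\<Sum>v\<leftarrow>vs. ketbra v v)"
      by blast
    show ?thesis
    proof (intro exI[of _ "v # vs"] conjI)
      show "\<forall>v\<in>set (v # vs). \<exists>a. \<forall>i. v $ i \<noteq> 0 \<longrightarrow> p i = a" using vs(1) p by auto
      show "M = (\<Sum>v\<leftarrow>v # vs. ketbra v v)" by (simp flip: vs(2))
    qed
  qed
qed

section \<open>Kraus maps and sums of rank-one operators\<close>

lemma block_positive_sandwich:
  assumes "block_positive n X"
  shows "block_positive n (\<lambda>i j. K ** X i j ** adj K)"
  unfolding block_positive_def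
proof
  fix v
  \<comment> \<open>The outer factors move to the test vectors: the form of the new block matrix at
    \<open>v\<close> is that of \<open>X\<close> at the vectors \<open>adj K *v v i\<close>.\<close>
  have "cinner (v i) (K ** X i j ** adj K *v v j) = cinner (adj K *v v i) (X i j *v (adj K *v v j))"
    for i j
    by (simp add: cinner_adj[of _ K] flip: matrix_vector_mul_assoc)
  then show "(\<Sum>i<n. \<Sum>j<n. cinner (v i) (K ** X i j ** adj K *v v j)) \<in> \<real>\<^sub>\<ge>\<^sub>0"
    using assms unfolding block_positive_def by simp
qed

lemma block_positive_add:
  assumes "block_positive n X" "block_positive n Y"
  shows "block_positive n (\<lambda>i j. X i j + Y i j)"
  using assms
  by (simp add: block_positive_def matrix_vector_mult_add_rdistrib cinner_add_right sum.distrib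
      nonneg_Reals_add_I)

lemma completely_positive_Kraus: "completely_positive (\<lambda>X. \<Sum>K\<leftarrow>Ks. K ** X ** adj K)"
proof -
  have "block_positive n (\<lambda>i j. \<Sum>K\<leftarrow>Ks. K ** X i j ** adj K)" if "block_positive n X" for n X
  proof (induction Ks)
    case Nil
    show ?case by (simp add: block_positive_def cinner_def)
  next
    case (Cons K Ks)
    show ?case
      using block_positive_add[OF block_positive_sandwich[OF that] Cons.IH] by simp
  qed
  then show ?thesis by (simp add: completely_positive_def)
qed

lemma positive_ketbra: "positive (ketbra v v)"
  unfolding positive_def
proof
  fix w
  have "cinner w (ketbra v v *v w) = cinner v w * cnj (cinner v w)"
    by (simp add: ketbra_mult_vector cinner_smult_right cnj_cinner)
  then show "cinner w (ketbra v v *v w) \<in> \<real>\<^sub>\<ge>\<^sub>0"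
    by (simp add: complex_nonneg_Reals_iff)
qed

lemma positive_add: "positive X \<Longrightarrow> positive Y \<Longrightarrow> positive (X + Y)"
  by (simp add: positive_def matrix_vector_mult_add_rdistrib cinner_add_right nonneg_Reals_add_I)

lemma positive_sum_list: "(\<And>k. k \<in> set ks \<Longrightarrow> positive (f k)) \<Longrightarrow> positive (\<Sum>k\<leftarrow>ks. f k)"
  by (induction ks) (simp_all add: positive_add, simp add: positive_def cinner_def)


section \<open>Operators in coordinates\<close>

interpretation oper: vector_space scale
  by (rule vector_space_scale)

lemma sum_ketbra: "X = (\<Sum>i\<in>UNIV. \<Sum>j\<in>UNIV. scale (X $ i $ j) (ketbra (axis i 1) (axis j 1)))"
proof -
  have "(\<Sum>i\<in>UNIV. \<Sum>j\<in>UNIV. scale (X $ i $ j) (ketbra (axis i 1) (axis j 1))) $ k $ l =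
      (\<Sum>i\<in>UNIV. \<Sum>j\<in>UNIV. if j = l then if i = k then X $ i $ j else 0 else 0)" for k l
    unfolding sum_component by (intro sum.cong refl) (auto simp: scale_def ketbra_axis)
  then show ?thesis by (simp add: vec_eq_iff)
qed

text \<open>The matrices supported on \<open>P\<close> form a subspace containing the generators;
  conversely, the expansion of such a matrix in matrix units has nonzero coefficients only at
  generators.\<close>

lemma span_ketbra:
  "X \<in> oper.span {ketbra (axis i 1) (axis j 1) | i j. P i j} \<longleftrightarrow>
    (\<forall>i j. X $ i $ j \<noteq> 0 \<longrightarrow> P i j)"
proof
  assume "X \<in> oper.span {ketbra (axis i 1) (axis j 1) | i j. P i j}"
  then show "\<forall>i j. X $ i $ j \<noteq> 0 \<longrightarrow> P i j"
  proof (rule oper.span_induct)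
    show "oper.subspace {X. \<forall>i j. X $ i $ j \<noteq> 0 \<longrightarrow> P i j}"
      by (auto simp: oper.subspace_def scale_def) (metis add_0_left)
  qed (auto simp: ketbra_axis split: if_splits)
next
  assume P: "\<forall>i j. X $ i $ j \<noteq> 0 \<longrightarrow> P i j"
  have "scale (X $ i $ j) (ketbra (axis i 1) (axis j 1)) \<in>
      oper.span {ketbra (axis i 1) (axis j 1) | i j. P i j}" for i j
  proof (cases "X $ i $ j = 0")
    case True
    then show ?thesis by (simp add: oper.span_zero)
  next
    case False
    with P show ?thesis by (blast intro: oper.span_scale oper.span_base)
  qed
  then show "X \<in> oper.span {ketbra (axis i 1) (axis j 1) | i j. P i j}"
    by (subst sum_ketbra) (intro oper.span_sum)
qed

lemma block_diagonal_iff: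
  "block_diagonal X \<longleftrightarrow> (\<forall>S T. X $ S $ T \<noteq> 0 \<longrightarrow> (even (card S) \<longleftrightarrow> even (card T)))"
proof -
  have "{ketbra (occ S) (occ T) | S T. even (card S) \<and> even (card T)} \<union>
      {ketbra (occ S) (occ T) | S T. odd (card S) \<and> odd (card T)} =
      {ketbra (axis S 1) (axis T 1) | S T :: 'a set. even (card S) \<longleftrightarrow> even (card T)}"
    unfolding occ_axis by blast
  then show ?thesis unfolding block_diagonal_def by (simp add: span_ketbra)
qed

lemma anti_block_diagonal_iff:
  "anti_block_diagonal X \<longleftrightarrow> (\<forall>S T. X $ S $ T \<noteq> 0 \<longrightarrow> (even (card S) \<longleftrightarrow> odd (card T)))"
proof -
  have "{ketbra (occ S) (occ T) | S T. even (card S) \<and> odd (card T)} \<union>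
      {ketbra (occ S) (occ T) | S T. odd (card S) \<and> even (card T)} =
      {ketbra (axis S 1) (axis T 1) | S T :: 'a set. even (card S) \<longleftrightarrow> odd (card T)}"
    unfolding occ_axis by blast
  then show ?thesis unfolding anti_block_diagonal_def by (simp add: span_ketbra)
qed

lemma parity_entry: "parity $ S $ T = (if S = T then (-1) ^ card S else 0)"
proof -
  have "parity $ S $ T = (\<Sum>U\<in>UNIV. if U = S then if S = T then (-1) ^ card S else 0 else 0)"
    unfolding parity_def sum_component
    by (intro sum.cong refl) (auto simp: scale_def occ_axis ketbra_axis)
  then show ?thesis by simp
qed

text \<open>The two products multiply the entry at \<open>S\<close>, \<open>T\<close> by the sign of
  \<open>T\<close> and of \<open>S\<close> respectively, so the signs must agree wherever the entry
  is nonzero. The condition is the same as in \<open>block_diagonal_iff\<close>.\<close>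

lemma commutes_parity_iff:
  "X ** parity = parity ** X \<longleftrightarrow> (\<forall>S T. X $ S $ T \<noteq> 0 \<longrightarrow> (even (card S) \<longleftrightarrow> even (card T)))"
proof -
  have "(X ** parity) $ S $ T = X $ S $ T * (-1) ^ card T"
    "(parity ** X) $ S $ T = (-1) ^ card S * X $ S $ T" for S T
    by (simp_all add: matrix_matrix_mult_def parity_entry if_distrib[of "\<lambda>c. _ * c"]
        if_distrib[of "\<lambda>c. c * _"] cong: if_cong)
  then show ?thesis
    by (simp add: vec_eq_iff minus_one_power_iff) (auto simp: eq_neg_iff_add_eq_0 neg_eq_iff_add_eq_0)
qed

text \<open>Testing the defining identity with a single matrix unit reads off one entry. The result
  is the usual partial trace, without fermionic signs, because \<open>wedge\<close> is a plain
  product of entries by \<open>wedge_Plus\<close>.\<close>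

lemma reduced_state_entry:
  fixes \<rho> :: "('a::{finite,linorder} + 'b::{finite,linorder}) oper"
  shows "reduced_state \<rho> $ x $ x' = (\<Sum>y\<in>UNIV. \<rho> $ (x <+> y) $ (x' <+> y))"
proof -
  have "\<forall>X. trace (X ** reduced_state \<rho>) = trace (wedge X (mat 1 :: 'b oper) ** \<rho>)"
    unfolding reduced_state_def by (rule theI'[OF reduced_state_unique])
  moreover have "reduced_state \<rho> $ x $ x' =
      trace (ketbra (axis x' 1) (axis x 1) ** reduced_state \<rho>)"
  proof -
    have "trace (ketbra (axis x' 1) (axis x 1) ** reduced_state \<rho>) =
        (\<Sum>k\<in>UNIV. \<Sum>l\<in>UNIV. if l = x then if k = x' then reduced_state \<rho> $ l $ k else 0 else 0)"
      unfolding trace_def matrix_matrix_mult_def vec_lambda_beta ketbra_axis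
      by (intro sum.cong refl) auto
    then show ?thesis by simp
  qed
  moreover have "trace (wedge (ketbra (axis x' 1) (axis x 1)) (mat 1 :: 'b oper) ** \<rho>) =
      (\<Sum>y\<in>UNIV. \<rho> $ (x <+> y) $ (x' <+> y))"
  proof -
    have "trace (wedge (ketbra (axis x' 1) (axis x 1)) (mat 1 :: 'b oper) ** \<rho>) =
        (\<Sum>u\<in>UNIV. \<Sum>y\<in>UNIV. \<Sum>v\<in>UNIV. \<Sum>z\<in>UNIV.
          if z = y then if v = x then if u = x' then \<rho> $ (v <+> z) $ (u <+> y) else 0 else 0 else 0)"
      unfolding trace_def matrix_matrix_mult_def vec_lambda_beta sum_Plus wedge_Plus mat_def
        ketbra_axis
      by (intro sum.cong refl) auto
    then show ?thesis by (simp add: sum_if_const)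
  qed
  ultimately show ?thesis by simp
qed

text \<open>This links the parity of a vector on the joint system to the block structure of an
  operator: even total parity means row and column indices of equal parity.\<close>

lemma card_Plus_parity: "even (card (x <+> y)) \<longleftrightarrow> (even (card x) \<longleftrightarrow> even (card y))"
  for x :: "'a::finite set" and y :: "'b::finite set"
  by (simp add: card_Plus)


section \<open>The Choi matrix\<close>

lemma psi_plus_entry:
  "(psi_plus :: ('m::{finite,linorder} + 'm) fock) $ (x <+> y) =
    (if x = y then 1 / complex_of_real (sqrt (2 ^ CARD('m))) else 0)"
proof -
  have "((\<Sum>S | even (card S). wedge_ket S S) + (\<Sum>S | odd (card S). wedge_ket S S) :: ('m + 'm) fock) =
      (\<Sum>S\<in>UNIV. wedge_ket S S)"
    by (subst sum.union_disjoint[symmetric]) (auto intro!: sum.cong)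
  moreover have "(\<Sum>S\<in>UNIV. wedge_ket S S :: ('m + 'm) fock) $ (x <+> y) =
      (\<Sum>S\<in>UNIV. if S = x then if x = y then 1 else 0 else 0)"
    unfolding sum_component by (intro sum.cong refl) (auto simp: wedge_ket_axis axis_def)
  ultimately show ?thesis by (simp add: psi_plus_def)
qed

text \<open>\<open>psi_plus\<close> pairs only equal occupation sets, so the double sum over basis
  elements keeps one term. The first subsystem carries the input indices of \<open>E\<close> and the
  second its output indices.\<close>

lemma id_wedge_psi_plus:
  "id_wedge E (ketbra psi_plus psi_plus) $ (x <+> y) $ (x' <+> y') =
    E (ketbra (axis x 1) (axis x' 1)) $ y $ y' / 2 ^ CARD('m)"
  for E :: "'m::{finite,linorder} oper \<Rightarrow> 'm oper"
proof -
  let ?c = "complex_of_real (sqrt (2 ^ CARD('m)))"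
  \<comment> \<open>The ket and the bra each contribute one normalisation factor.\<close>
  have c: "?c * ?c = 2 ^ CARD('m)" by (simp flip: of_real_mult)
  have "id_wedge E (ketbra psi_plus psi_plus) $ (x <+> y) $ (x' <+> y') =
      (\<Sum>v\<in>UNIV. \<Sum>v'\<in>UNIV. if v' = x' then if v = x then
        E (ketbra (axis v 1) (axis v' 1)) $ y $ y' / (?c * ?c) else 0 else 0)"
    unfolding id_wedge_Plus by (intro sum.cong refl) (auto simp: ketbra_def psi_plus_entry occ_axis)
  then show ?thesis by (simp add: c)
qed

section \<open>Injectivity\<close>

lemma linear_ketbra_expand:
  assumes "Vector_Spaces.linear scale scale E"
  shows "E X = (\<Sum>i\<in>UNIV. \<Sum>j\<in>UNIV. scale (X $ i $ j) (E (ketbra (axis i 1) (axis j 1))))"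
proof -
  interpret E: Vector_Spaces.linear scale scale E by fact
  show ?thesis
    by (subst sum_ketbra) (simp add: E.sum E.scale)
qed

lemma trace_ketbra: "trace (ketbra (axis i 1) (axis j 1)) = (if i = j then 1 else 0)"
  by (simp add: trace_def ketbra_axis cong: conj_cong)

text \<open>Up to the factor \<open>1 / 2 ^ CARD('m)\<close>, the entries of the image are those of
  \<open>E\<close> on all matrix units, and these values determine a linear map.\<close>

lemma inj_on_id_wedge:
  "inj_on (\<lambda>E :: 'm::{finite,linorder} oper \<Rightarrow> 'm oper. id_wedge E (ketbra psi_plus psi_plus))
    {E. Vector_Spaces.linear scale scale E}"
proof (rule inj_onI, safe)
  fix E F :: "'m oper \<Rightarrow> 'm oper"
  assume lin: "Vector_Spaces.linear scale scale E" "Vector_Spaces.linear scale scale F"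
    and eq: "id_wedge E (ketbra psi_plus psi_plus) = id_wedge F (ketbra psi_plus psi_plus)"
  have "E (ketbra (axis x 1) (axis x' 1)) $ y $ y' = F (ketbra (axis x 1) (axis x' 1)) $ y $ y'"
    for x x' y y'
    using id_wedge_psi_plus[of E x y x' y'] id_wedge_psi_plus[of F x y x' y'] eq by simp
  then have basis: "E (ketbra (axis x 1) (axis x' 1)) = F (ketbra (axis x 1) (axis x' 1))" for x x'
    by (simp add: vec_eq_iff)
  show "E = F"
  proof
    fix X
    show "E X = F X"
      unfolding linear_ketbra_expand[OF lin(1), of X] linear_ketbra_expand[OF lin(2), of X] basis ..
  qed
qed

section \<open>Kraus operators as vectors\<close>

text \<open>For the Kraus operator \<open>K\<close> this is \<open>\<Sum>x. |x> \<and> K|x>\<close>.\<close>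

definition vec_of_oper :: "'m::{finite,linorder} oper \<Rightarrow> ('m + 'm) fock" where
  "vec_of_oper K = (\<chi> U. K $ (Inr -` U) $ (Inl -` U))"

lemma vec_of_oper_entry: "vec_of_oper K $ (x <+> y) = K $ y $ x"
proof -
  have "Inr -` (x <+> y) = y" "Inl -` (x <+> y) = x" by auto
  then show ?thesis by (simp add: vec_of_oper_def)
qed

lemma Plus_vimage: "(Inl -` U) <+> (Inr -` U) = U"
proof -
  have "z \<in> U \<longleftrightarrow> z \<in> (Inl -` U) <+> (Inr -` U)" for z by (cases z) auto
  then show ?thesis by blast
qed

text \<open>The matrix unit selects column \<open>x\<close> of \<open>K\<close> and row
  \<open>x'\<close> of \<open>adj K\<close>, so each summand on either side is
  \<open>K $ y $ x * cnj (K $ y' $ x')\<close>.\<close>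

lemma Kraus_ketbra_entry:
  "(\<Sum>K\<leftarrow>Ks. K ** ketbra (axis x 1) (axis x' 1) ** adj K) $ y $ y' =
    (\<Sum>K\<leftarrow>Ks. ketbra (vec_of_oper K) (vec_of_oper K)) $ (x <+> y) $ (x' <+> y')"
  unfolding sum_list_nth2 sandwich_ketbra by (simp add: adj_def ketbra_def vec_of_oper_entry)

lemma id_wedge_psi_plus_Kraus:
  fixes E :: "'m::{finite,linorder} oper \<Rightarrow> 'm oper"
  assumes "\<And>X. E X = (\<Sum>K\<leftarrow>Ks. K ** X ** adj K)"
  shows "id_wedge E (ketbra psi_plus psi_plus) =
    scale (1 / 2 ^ CARD('m)) (\<Sum>K\<leftarrow>Ks. ketbra (vec_of_oper K) (vec_of_oper K))"
  by (rule oper_Plus_eqI) (simp add: id_wedge_psi_plus assms Kraus_ketbra_entry scale_def)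

section \<open>From channels to states\<close>

lemma positive_scale:
  assumes "positive X" "c \<in> \<real>\<^sub>\<ge>\<^sub>0"
  shows "positive (scale c X)"
proof -
  have "scale c X *v v = c *s (X *v v)" for v
    by (simp add: vec_eq_iff scale_def matrix_vector_mult_def sum_distrib_left mult.assoc)
  then show ?thesis
    using assms by (simp add: positive_def cinner_smult_right nonneg_Reals_mult_I)
qed

lemma card_UNIV_set: "CARD('m::finite set) = 2 ^ CARD('m)"
  by (simp add: card_Pow flip: Pow_UNIV)

text \<open>The coordinates of \<open>U\<close> in the two subsystems are the column and row of
  \<open>K\<close>. By \<open>card_Plus_parity\<close>, \<open>a\<close> is \<open>True\<close> in
  the block-diagonal case and \<open>False\<close> in the anti-block-diagonal case.\<close>

lemma vec_of_oper_parity: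
  assumes "block_diagonal K \<or> anti_block_diagonal K"
  obtains a where "\<And>U. vec_of_oper K $ U \<noteq> 0 \<Longrightarrow> even (card U) = a"
proof -
  have *: "even (card U) \<longleftrightarrow> (even (card (Inl -` U)) \<longleftrightarrow> even (card (Inr -` U)))"
    for U :: "('a + 'a) set"
    using card_Plus_parity[of "Inl -` U" "Inr -` U"] by (simp add: Plus_vimage)
  from assms show thesis
  proof
    assume "block_diagonal K"
    then show thesis
      by (intro that[of True]) (auto simp: block_diagonal_iff vec_of_oper_def *)
  next
    assume "anti_block_diagonal K"
    then show thesis
      by (intro that[of False]) (auto simp: anti_block_diagonal_iff vec_of_oper_def *)
  qed
qed

lemma sum_list_nonzeroE:
  fixes f :: "'k \<Rightarrow> 'b::monoid_add"
  assumes "(\<Sum>k\<leftarrow>ks. f k) \<noteq> 0"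
  obtains k where "k \<in> set ks" "f k \<noteq> 0"
  using assms by (induction ks) (auto, fastforce)

lemma id_wedge_psi_plus_state:
  fixes E :: "'m::{finite,linorder} oper \<Rightarrow> 'm oper"
  assumes "fermionic_channel E"
  defines "\<rho> \<equiv> id_wedge E (ketbra psi_plus psi_plus)"
  shows "fermionic_state \<rho>" "reduced_state \<rho> = mat (1 / 2 ^ CARD('m))"
proof -
  obtain Ks where Ks: "\<And>K. K \<in> set Ks \<Longrightarrow> block_diagonal K \<or> anti_block_diagonal K"
    and E: "\<And>X. E X = (\<Sum>K\<leftarrow>Ks. K ** X ** adj K)"
    using assms by (auto simp: fermionic_channel_def)
  have tr: "trace (E X) = trace X" for X using assms by (simp add: fermionic_channel_def)
  have \<rho>: "\<rho> = scale (1 / 2 ^ CARD('m)) (\<Sum>K\<leftarrow>Ks. ketbra (vec_of_oper K) (vec_of_oper K))"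
    unfolding \<rho>_def by (rule id_wedge_psi_plus_Kraus[OF E])
  have "positive \<rho>"
    unfolding \<rho>
    by (intro positive_scale positive_sum_list positive_ketbra) (simp add: complex_nonneg_Reals_iff)
  \<comment> \<open>Tracing out the second subsystem traces the output of \<open>E\<close>, so trace
    preservation leaves the trace of a matrix unit.\<close>
  have partial: "(\<Sum>y\<in>UNIV. \<rho> $ (x <+> y) $ (x' <+> y)) = (if x = x' then 1 / 2 ^ CARD('m) else 0)" for x x'
  proof -
    have "(\<Sum>y\<in>UNIV. \<rho> $ (x <+> y) $ (x' <+> y)) =
        trace (E (ketbra (axis x 1) (axis x' 1))) / 2 ^ CARD('m)"
      by (simp add: \<rho>_def id_wedge_psi_plus trace_def sum_divide_distrib)
    then show ?thesis by (simp add: tr trace_ketbra)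
  qed
  then show "reduced_state \<rho> = mat (1 / 2 ^ CARD('m))"
    by (simp add: vec_eq_iff reduced_state_entry mat_def)
  have "trace \<rho> = 1"
    by (simp add: trace_def sum_Plus partial card_UNIV_set)
  moreover have "\<rho> ** parity = parity ** \<rho>"
    unfolding commutes_parity_iff
  proof (intro allI impI)
    fix S T
    assume "\<rho> $ S $ T \<noteq> 0"
    \<comment> \<open>Some summand must be nonzero here, which puts \<open>S\<close> and
      \<open>T\<close> in the support of the same vector.\<close>
    then have "(\<Sum>K\<leftarrow>Ks. ketbra (vec_of_oper K) (vec_of_oper K) $ S $ T) \<noteq> 0"
      by (auto simp: \<rho> scale_def sum_list_nth2)
    then obtain K where "K \<in> set Ks" "vec_of_oper K $ S \<noteq> 0" "vec_of_oper K $ T \<noteq> 0"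
      by (elim sum_list_nonzeroE) (auto simp: ketbra_def)
    then show "even (card S) \<longleftrightarrow> even (card T)"
      using vec_of_oper_parity[OF Ks] by metis
  qed
  ultimately show "fermionic_state \<rho>"
    using \<open>positive \<rho>\<close> by (simp add: fermionic_state_def density_operator_def)
qed

section \<open>From states to channels\<close>

lemma linear_Kraus: "Vector_Spaces.linear scale scale (\<lambda>X. \<Sum>K\<leftarrow>Ks. K ** X ** adj K)"
proof -
  have add: "(A + B) ** C = A ** C + B ** C" for A B C :: "complex ^ 'a ^ 'a"
    by (simp add: vec_eq_iff matrix_matrix_mult_def sum.distrib algebra_simps)
  have "K ** scale c X ** adj K = scale c (K ** X ** adj K)" for K X :: "complex ^ 'a ^ 'a" and c
    by (simp add: vec_eq_iff scale_def matrix_matrix_mult_def sum_distrib_left sum_distrib_right mult_ac)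
  moreover have "K ** (X + Y) ** adj K = K ** X ** adj K + K ** Y ** adj K"
    for K X Y :: "complex ^ 'a ^ 'a"
    by (simp add: matrix_add_ldistrib add)
  ultimately have "(\<Sum>K\<leftarrow>Ks. K ** scale c X ** adj K) = scale c (\<Sum>K\<leftarrow>Ks. K ** X ** adj K)"
    "(\<Sum>K\<leftarrow>Ks. K ** (X + Y) ** adj K) = (\<Sum>K\<leftarrow>Ks. K ** X ** adj K) + (\<Sum>K\<leftarrow>Ks. K ** Y ** adj K)"
    for c X Y
    by (induction Ks) (simp_all add: oper.scale_right_distrib algebra_simps)
  then show ?thesis
    by (intro Vector_Spaces.linear.intro module_hom.intro module_hom_axioms.intro
      oper.vector_space_axioms oper.module_axioms)
qed

lemma ex_fermionic_channel:
  fixes \<rho> :: "('m::{finite,linorder} + 'm) oper"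
  assumes "fermionic_state \<rho>" "reduced_state \<rho> = mat (1 / 2 ^ CARD('m))"
  shows "\<exists>E. fermionic_channel E \<and> id_wedge E (ketbra psi_plus psi_plus) = \<rho>"
proof -
  let ?d = "2 ^ CARD('m) :: complex"
  \<comment> \<open>Multiplying by \<open>?d\<close> recovers the unnormalised Choi matrix, whose
    rank-one terms give the Kraus operators without extra factors.\<close>
  have "positive (scale ?d \<rho>)"
    using assms(1)
    by (intro positive_scale) (simp_all add: fermionic_state_def density_operator_def complex_nonneg_Reals_iff)
  moreover have "even (card S) = even (card T)" if "scale ?d \<rho> $ S $ T \<noteq> 0" for S T
    using assms(1) that by (simp add: fermionic_state_def commutes_parity_iff scale_def)
  ultimately obtain vs where vs: "\<And>v. v \<in> set vs \<Longrightarrow> \<exists>a. \<forall>S. v $ S \<noteq> 0 \<longrightarrow> even (card S) = a"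
    and \<rho>: "scale ?d \<rho> = (\<Sum>v\<leftarrow>vs. ketbra v v)"
    using positive_decomposition[of "scale ?d \<rho>" "\<lambda>S. even (card S)"] by blast
  \<comment> \<open>The inverse of \<open>vec_of_oper\<close>: rows come from the second subsystem
    and columns from the first.\<close>
  define op :: "('m + 'm) fock \<Rightarrow> 'm oper" where "op v = (\<chi> y x. v $ (x <+> y))" for v
  have vec_op: "vec_of_oper (op v) = v" for v
    by (simp add: vec_eq_iff vec_of_oper_def op_def Plus_vimage)
  define Ks where "Ks = map op vs"
  define E where "E X = (\<Sum>K\<leftarrow>Ks. K ** X ** adj K)" for X
  have choi: "id_wedge E (ketbra psi_plus psi_plus) = \<rho>"
  proof -
    have "id_wedge E (ketbra psi_plus psi_plus) = scale (1 / ?d) (scale ?d \<rho>)"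
      unfolding \<rho> id_wedge_psi_plus_Kraus[OF E_def] by (simp add: Ks_def o_def vec_op)
    then show ?thesis by simp
  qed
  have BD: "block_diagonal K \<or> anti_block_diagonal K" if K: "K \<in> set Ks" for K
  proof -
    obtain v where v: "v \<in> set vs" "K = op v" using K by (auto simp: Ks_def)
    obtain a where "\<And>S. v $ S \<noteq> 0 \<Longrightarrow> even (card S) = a" using vs[OF v(1)] by blast
    \<comment> \<open>The common parity of the support of \<open>v\<close> decides whether rows and
      columns of \<open>K\<close> have equal or opposite parity.\<close>
    then have a: "(even (card x) \<longleftrightarrow> even (card y)) = a" if "K $ y $ x \<noteq> 0" for x y
      using that card_Plus_parity[of x y] by (simp add: v(2) op_def)
    show ?thesis
      unfolding block_diagonal_iff anti_block_diagonal_iff using a by (cases a) blast+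
  qed
  have lin: "Vector_Spaces.linear scale scale E"
    using linear_Kraus[of Ks] by (simp add: E_def[abs_def])
  \<comment> \<open>The computation of the reduced state read backwards: the hypothesis on
    \<open>reduced_state\<close> gives trace preservation on matrix units, and linearity extends it
    to all operators.\<close>
  have tr_basis: "trace (E (ketbra (axis x 1) (axis x' 1))) = (if x = x' then 1 else 0)" for x x'
  proof -
    have "trace (E (ketbra (axis x 1) (axis x' 1))) = ?d * (\<Sum>y\<in>UNIV. \<rho> $ (x <+> y) $ (x' <+> y))"
      by (simp add: trace_def id_wedge_psi_plus sum_distrib_left flip: choi)
    also have "\<dots> = ?d * mat (1 / ?d) $ x $ x'"
      by (simp flip: reduced_state_entry assms(2))
    finally show ?thesis by (simp add: mat_def)
  qed
  have "trace (E X) = trace X" for X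
  proof -
    have "trace (E X) = (\<Sum>i\<in>UNIV. \<Sum>j\<in>UNIV. X $ i $ j * trace (E (ketbra (axis i 1) (axis j 1))))"
    proof -
      have "trace (E X) = (\<Sum>k\<in>UNIV. \<Sum>i\<in>UNIV. \<Sum>j\<in>UNIV.
          X $ i $ j * E (ketbra (axis i 1) (axis j 1)) $ k $ k)"
        unfolding trace_def unfolding linear_ketbra_expand[OF lin, of X] by (simp add: scale_def)
      also have "\<dots> = (\<Sum>i\<in>UNIV. \<Sum>k\<in>UNIV. \<Sum>j\<in>UNIV.
          X $ i $ j * E (ketbra (axis i 1) (axis j 1)) $ k $ k)" by (rule sum.swap)
      also have "\<dots> = (\<Sum>i\<in>UNIV. \<Sum>j\<in>UNIV. \<Sum>k\<in>UNIV.
          X $ i $ j * E (ketbra (axis i 1) (axis j 1)) $ k $ k)"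
        by (intro sum.cong refl sum.swap)
      finally show ?thesis by (simp add: trace_def sum_distrib_left)
    qed
    also have "\<dots> = trace X"
      unfolding tr_basis by (simp add: trace_def if_distrib[of "\<lambda>c. _ * c"] cong: if_cong)
    finally show ?thesis .
  qed
  moreover have "completely_positive E"
    using completely_positive_Kraus[of Ks] by (simp add: E_def[abs_def])
  ultimately have "fermionic_channel E"
    using lin BD E_def unfolding fermionic_channel_def by blast
  with choi show ?thesis by blast
qed

theorem mainTheorem5:
  shows "bij_betw
    (\<lambda>E :: 'm::{finite,linorder} oper \<Rightarrow> 'm oper. id_wedge E (ketbra psi_plus psi_plus))
    {E. fermionic_channel E}
    {\<rho> :: ('m + 'm) oper. fermionic_state \<rho> \<and> reduced_state \<rho> = mat (1 / 2 ^ CARD('m))}"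
proof (rule bij_betw_imageI)
  show "inj_on (\<lambda>E :: 'm oper \<Rightarrow> 'm oper. id_wedge E (ketbra psi_plus psi_plus)) {E. fermionic_channel E}"
    by (rule inj_on_subset[OF inj_on_id_wedge]) (auto simp: fermionic_channel_def)
  show "(\<lambda>E :: 'm oper \<Rightarrow> 'm oper. id_wedge E (ketbra psi_plus psi_plus)) ` {E. fermionic_channel E} =
      {\<rho>. fermionic_state \<rho> \<and> reduced_state \<rho> = mat (1 / 2 ^ CARD('m))}"
    using id_wedge_psi_plus_state ex_fermionic_channel by blast
qed

end
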